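(* Let $M, D>0$ and let $L\in\mathbb{R}^{n\times n}$ be the Laplacian matrix of an undirected network on $n$ nodes with positive edge weights $B_{ij}$, with eigenvalues $0=\lambda_1\le\lambda_2\le\dots\le\lambda_n$. Consider the power network described by the linearized swing dynamics $$\begin{bmatrix}\dot{\boldsymbol\theta}\\ \ddot{\boldsymbol\theta}\end{bmatrix}=A\begin{bmatrix}\boldsymbol\theta\\ \dot{\boldsymbol\theta}\end{bmatrix}+\begin{bmatrix}\mathbf{0}_n\\ \frac1M I_n\end{bmatrix}\mathbf{w}(t),\qquad A=\begin{bmatrix}\mathbf{0}_n & I_n\\ -\frac1M L & -\frac DM I_n\end{bmatrix}.$$ The eigenvalues of this system (that is, of $A$) are given by $$s_{i1}=-\frac{D}{2M}+\frac{1}{2M}\sqrt{D^2-4M\lambda_i},\qquad s_{i2}=-\frac{D}{2M}-\frac{1}{2M}\sqrt{D^2-4M\lambda_i},\qquad i=1,\dots,n,$$ and the smallest damping ratio $\zeta_{\min}$ of any mode equals $$\zeta_{\min}=\frac{D}{2\sqrt{M\lambda_n}} .$$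
   Context: Here $\boldsymbol\theta(t)\in\mathbb{R}^n$ is the vector of generator voltage phase angles, $\mathbf{w}(t)\in\mathbb{R}^n$ is the disturbance, and $M$ and $D$ are the inertia and damping constants, identical for all generators. The Laplacian is $L=\operatorname{diag}(d_1,\dots,d_n)-W$, where $W$ is the symmetric matrix with $W_{ij}=B_{ij}>0$ if $\{i,j\}$ is an edge and $0$ otherwise, and $d_i=\sum_j W_{ij}$. The $i$-th mode is the pair $(s_{i1},s_{i2})$ of roots of the factor $s^2+\frac DM s+\frac{\lambda_i}{M}$ of the characteristic polynomial of $A$; its natural frequency $\omega_{n,i}$ and damping ratio $\zeta_i$ are determined by $2\zeta_i\omega_{n,i}=\frac DM$ and $\omega_{n,i}^2=\frac{\lambda_i}{M}$. *)

theory Defs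
  imports "Jordan_Normal_Form.Spectral_Radius"
begin

text \<open>
  Nodes are numbered \<open>0, \<dots>, n - 1\<close>, as row and column indices of matrices are; eigenvalues and
  modes are numbered \<open>1, \<dots>, n\<close>. Edges are two-element sets, so there are no self-loops, and the
  values \<open>B i j\<close> for which \<open>{i, j}\<close> is not an edge are irrelevant.
\<close>

definition weighted_network :: "nat \<Rightarrow> nat set set \<Rightarrow> (nat \<Rightarrow> nat \<Rightarrow> real) \<Rightarrow> bool" where
  "weighted_network n E B \<longleftrightarrow>
     (\<forall>e\<in>E. \<exists>i<n. \<exists>j<n. i \<noteq> j \<and> e = {i, j}) \<and>
     (\<forall>i j. {i, j} \<in> E \<longrightarrow> B i j > 0 \<and> B i j = B j i)"

definition weight_matrix :: "nat \<Rightarrow> nat set set \<Rightarrow> (nat \<Rightarrow> nat \<Rightarrow> real) \<Rightarrow> real mat" where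
  "weight_matrix n E B = mat n n (\<lambda>(i, j). if {i, j} \<in> E then B i j else 0)"

definition laplacian :: "nat \<Rightarrow> nat set set \<Rightarrow> (nat \<Rightarrow> nat \<Rightarrow> real) \<Rightarrow> real mat" where
  "laplacian n E B =
     mat_diag n (\<lambda>i. \<Sum>j<n. weight_matrix n E B $$ (i, j)) - weight_matrix n E B"

text \<open>
  Equality of the characteristic polynomials expresses that \<open>ev 1 \<le> \<dots> \<le> ev n\<close> lists all eigenvalues,
  each repeated according to its algebraic multiplicity.
\<close>

definition ordered_eigenvalues :: "nat \<Rightarrow> real mat \<Rightarrow> (nat \<Rightarrow> real) \<Rightarrow> bool" where
  "ordered_eigenvalues n L ev \<longleftrightarrow>
     char_poly L = (\<Prod>i=1..n. [:- ev i, 1:]) \<and> mono_on {1..n} ev"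

text \<open>
  The state matrix of \<open>M \<theta>'' + D \<theta>' + L \<theta> = w\<close>, written as a first-order system
  in the state \<open>(\<theta>, \<theta>')\<close>.
\<close>

definition swing_matrix :: "nat \<Rightarrow> real \<Rightarrow> real \<Rightarrow> real mat \<Rightarrow> real mat" where
  "swing_matrix n M D L =
     four_block_mat (0\<^sub>m n n) (1\<^sub>m n) ((- 1 / M) \<cdot>\<^sub>m L) ((- D / M) \<cdot>\<^sub>m 1\<^sub>m n)"

text \<open>The polynomial \<open>s\<^sup>2 + (D / M) s + l / M\<close>, whose pair of roots is the mode belonging to \<open>l\<close>.\<close>

definition mode_factor :: "real \<Rightarrow> real \<Rightarrow> real \<Rightarrow> complex poly" where
  "mode_factor M D l = [:of_real (l / M), of_real (D / M), 1:]"

text \<open>The radicand may be negative; \<^const>\<open>csqrt\<close> is the principal complex square root.\<close>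

definition mode_root1 :: "real \<Rightarrow> real \<Rightarrow> real \<Rightarrow> complex" where
  "mode_root1 M D l =
     - of_real (D / (2 * M)) + of_real (1 / (2 * M)) * csqrt (of_real (D\<^sup>2 - 4 * M * l))"

definition mode_root2 :: "real \<Rightarrow> real \<Rightarrow> real \<Rightarrow> complex" where
  "mode_root2 M D l =
     - of_real (D / (2 * M)) - of_real (1 / (2 * M)) * csqrt (of_real (D\<^sup>2 - 4 * M * l))"

text \<open>
  The mode belonging to \<open>l\<close> has natural frequency \<open>\<omega>\<close> and damping ratio \<open>\<zeta>\<close>. This is a relation, not a
  function: for \<open>l = 0\<close> it forces \<open>\<omega> = 0\<close>, so if \<open>D \<noteq> 0\<close> and \<open>M \<noteq> 0\<close> that mode has no damping ratio.
\<close>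

definition mode_damping :: "real \<Rightarrow> real \<Rightarrow> real \<Rightarrow> real \<Rightarrow> real \<Rightarrow> bool" where
  "mode_damping M D l \<omega> \<zeta> \<longleftrightarrow> \<omega> \<ge> 0 \<and> 2 * \<zeta> * \<omega> = D / M \<and> \<omega>\<^sup>2 = l / M"

definition damping_ratios :: "nat \<Rightarrow> real \<Rightarrow> real \<Rightarrow> (nat \<Rightarrow> real) \<Rightarrow> real set" where
  "damping_ratios n M D ev = {\<zeta>. \<exists>i\<in>{1..n}. \<exists>\<omega>. mode_damping M D (ev i) \<omega> \<zeta>}"

definition is_smallest :: "real \<Rightarrow> real set \<Rightarrow> bool" where
  "is_smallest x S \<longleftrightarrow> x \<in> S \<and> (\<forall>y\<in>S. x \<le> y)"

end

theory Submission
  imports Defs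
begin

text \<open>
  The blocks of \<open>s I - A\<close> commute, so its determinant is \<open>det ((s\<^sup>2 + (D / M) s) I + L / M)\<close>, which is
  \<open>(- 1 / M)\<^sup>n\<close> times the characteristic polynomial of \<open>L\<close> at \<open>- M (s\<^sup>2 + (D / M) s)\<close>; it therefore splits
  into the mode factors. The damping ratio of a mode with \<open>\<lambda> > 0\<close> is \<open>D / (2 sqrt (M \<lambda>))\<close>, decreasing in
  \<open>\<lambda>\<close>. If there is an edge, then \<open>L\<close> has positive trace, so the largest eigenvalue is positive.
\<close>

lemma trace_mult_commute:
  fixes A B :: "'a :: comm_semiring_0 mat"
  assumes A: "A \<in> carrier_mat n m" and B: "B \<in> carrier_mat m n"
  shows "(\<Sum>i<n. (A * B) $$ (i, i)) = (\<Sum>j<m. (B * A) $$ (j, j))"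
proof -
  have "(\<Sum>i<n. (A * B) $$ (i, i)) = (\<Sum>i<n. \<Sum>j<m. A $$ (i, j) * B $$ (j, i))"
    using A B by (auto simp: scalar_prod_def atLeast0LessThan intro!: sum.cong)
  also have "\<dots> = (\<Sum>j<m. \<Sum>i<n. A $$ (i, j) * B $$ (j, i))"
    by (rule sum.swap)
  also have "\<dots> = (\<Sum>j<m. (B * A) $$ (j, j))"
    using A B by (auto simp: scalar_prod_def atLeast0LessThan mult.commute intro!: sum.cong)
  finally show ?thesis .
qed

text \<open>Schur decomposition makes \<open>A\<close> similar to a triangular matrix with the list
  \<open>es\<close> on its diagonal, and cyclicity of the trace makes it invariant under
  similarity.\<close>

lemma trace_eq_sum_eigenvalues:
  fixes A :: "'a :: conjugatable_ordered_field mat"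
  assumes A: "A \<in> carrier_mat n n" and cp: "char_poly A = (\<Prod>a\<leftarrow>es. [:- a, 1:])"
  shows "(\<Sum>i<n. A $$ (i, i)) = sum_list es"
proof -
  obtain B P Q where schur: "schur_decomposition A es = (B, P, Q)"
    by (cases "schur_decomposition A es") auto
  from schur_decomposition[OF A cp schur]
  have wit: "similar_mat_wit A B P Q" and diag: "diag_mat B = es" by auto
  from similar_mat_witD2[OF A wit]
  have QP: "Q * P = 1\<^sub>m n" and AB: "A = P * B * Q"
    and B: "B \<in> carrier_mat n n" and P: "P \<in> carrier_mat n n" and Q: "Q \<in> carrier_mat n n"
    by auto
  \<comment> \<open>Cyclicity is applied to the two factors \<open>P * B\<close> and
    \<open>Q\<close>, so that \<open>Q * P\<close> cancels next.\<close>
  have "(\<Sum>i<n. A $$ (i, i)) = (\<Sum>i<n. (Q * (P * B)) $$ (i, i))"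
    unfolding AB using P B Q by (intro trace_mult_commute) auto
  also have "Q * (P * B) = B"
    using assoc_mult_mat[OF Q P B] QP B by simp
  also have "(\<Sum>i<n. B $$ (i, i)) = sum_list (diag_mat B)"
    using B by (simp add: diag_mat_def interv_sum_list_conv_sum_set_nat atLeast0LessThan)
  finally show ?thesis by (simp add: diag)
qed

lemma laplacian_carrier: "laplacian n E B \<in> carrier_mat n n"
  unfolding laplacian_def weight_matrix_def by (intro minus_carrier_mat) simp

text \<open>The trace is the sum of the weighted degrees, and each edge adds a positive weight to
  the degrees of its endpoints.\<close>

lemma trace_laplacian_pos:
  assumes net: "weighted_network n E B" and E: "E \<noteq> {}"
  shows "(\<Sum>i<n. laplacian n E B $$ (i, i)) > 0"
proof -
  let ?w = "\<lambda>i j. if {i, j} \<in> E then B i j else 0"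
  have edge: "\<exists>i<n. \<exists>j<n. i \<noteq> j \<and> e = {i, j}" if "e \<in> E" for e
    using net that unfolding weighted_network_def by blast
  have weight: "B i j > 0" if "{i, j} \<in> E" for i j
    using net that unfolding weighted_network_def by blast
  \<comment> \<open>As there are no loops, the subtracted weight matrix vanishes on the diagonal,
    where only the degrees remain.\<close>
  have loop: "{i, i} \<notin> E" for i
    using edge[of "{i, i}"] by (auto simp: doubleton_eq_iff)
  have diag: "laplacian n E B $$ (i, i) = (\<Sum>j<n. ?w i j)" if "i < n" for i
    using that loop[of i] by (simp add: laplacian_def weight_matrix_def mat_diag_def)
  have nonneg: "?w i j \<ge> 0" for i j
    using weight by (auto intro: less_imp_le)
  obtain a b where a: "a < n" and b: "b < n" and ab: "{a, b} \<in> E"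
    using E edge by blast
  have "0 < ?w a b"
    using weight[OF ab] ab by simp
  also have "\<dots> \<le> (\<Sum>j<n. ?w a j)"
    using b nonneg by (intro member_le_sum) auto
  also have "\<dots> \<le> (\<Sum>i<n. \<Sum>j<n. ?w i j)"
    using a by (intro member_le_sum[where f = "\<lambda>i. \<Sum>j<n. ?w i j"] sum_nonneg nonneg) auto
  finally show ?thesis by (simp add: diag)
qed

text \<open>If the last eigenvalue in the ordering were at most 0, so would be their sum, which is
  the trace.\<close>

lemma largest_eigenvalue_pos:
  assumes net: "weighted_network n E B" and E: "E \<noteq> {}"
    and ord: "ordered_eigenvalues n (laplacian n E B) ev"
  shows "ev n > 0"
proof (rule ccontr)
  assume "\<not> ev n > 0"
  moreover have "ev i \<le> ev n" if "i \<in> {1..n}" for i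
    using ord that unfolding ordered_eigenvalues_def by (auto intro: mono_onD)
  ultimately have "(\<Sum>i=1..n. ev i) \<le> 0"
    by (intro sum_nonpos) force
  \<comment> \<open>The trace lemma takes its eigenvalues as a list, so the index set
    \<open>{1..n}\<close> becomes \<open>[1..<Suc n]\<close>.\<close>
  moreover have "(\<Sum>i<n. laplacian n E B $$ (i, i)) = sum_list (map ev [1..<Suc n])"
  proof (rule trace_eq_sum_eigenvalues[OF laplacian_carrier])
    show "char_poly (laplacian n E B) = (\<Prod>a\<leftarrow>map ev [1..<Suc n]. [:- a, 1:])"
      using ord unfolding ordered_eigenvalues_def
      by (simp add: prod.distinct_set_conv_list[symmetric] atLeastLessThanSuc_atLeastAtMost o_def
          del: upt_Suc)
  qed
  moreover have "sum_list (map ev [1..<Suc n]) = (\<Sum>i=1..n. ev i)"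
    by (simp add: interv_sum_list_conv_sum_set_nat atLeastLessThanSuc_atLeastAtMost del: upt_Suc)
  ultimately show False using trace_laplacian_pos[OF net E] by simp
qed

lemma swing_matrix_carrier:
  "L \<in> carrier_mat n n \<Longrightarrow> swing_matrix n M D L \<in> carrier_mat (n + n) (n + n)"
  by (simp add: swing_matrix_def)

lemma poly_char_poly_swing_matrix:
  fixes L :: "real mat"
  assumes L: "L \<in> carrier_mat n n" and M: "M \<noteq> 0"
  shows "poly (char_poly (swing_matrix n M D L)) x
    = (- 1 / M) ^ n * poly (char_poly L) (- M * (x\<^sup>2 + D / M * x))"
proof -
  let ?y = "- M * (x\<^sup>2 + D / M * x)"
  have "poly (char_poly (swing_matrix n M D L)) x = det (- char_matrix (swing_matrix n M D L) x)"
    by (rule char_poly_matrix[OF swing_matrix_carrier[OF L]])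
  also have "- char_matrix (swing_matrix n M D L) x
    = four_block_mat (x \<cdot>\<^sub>m 1\<^sub>m n) (- 1\<^sub>m n) ((1 / M) \<cdot>\<^sub>m L) ((x + D / M) \<cdot>\<^sub>m 1\<^sub>m n)"
    using L by (intro eq_matI) (auto simp: char_matrix_def swing_matrix_def)
  \<comment> \<open>The block determinant formula requires the two lower blocks to commute; the
    right one is a scalar multiple of the identity.\<close>
  also have "det \<dots> =
    det (x \<cdot>\<^sub>m 1\<^sub>m n * ((x + D / M) \<cdot>\<^sub>m 1\<^sub>m n) - (- 1\<^sub>m n) * ((1 / M) \<cdot>\<^sub>m L))"
  proof (rule det_four_block_mat)
    show "1 / M \<cdot>\<^sub>m L * ((x + D / M) \<cdot>\<^sub>m 1\<^sub>m n) = (x + D / M) \<cdot>\<^sub>m 1\<^sub>m n * (1 / M \<cdot>\<^sub>m L)"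
      using L by (intro eq_matI) (simp_all add: mult_smult_distrib[of _ n n _ n] mult_smult_assoc_mat[of _ n n _ n])
  qed (use L in auto)
  \<comment> \<open>The choice of \<open>?y\<close> is forced here: factoring \<open>- 1 / M\<close>
    out of \<open>x (x + D / M) I + L / M\<close> leaves \<open>?y I - L\<close>.\<close>
  also have "x \<cdot>\<^sub>m 1\<^sub>m n * ((x + D / M) \<cdot>\<^sub>m 1\<^sub>m n) - (- 1\<^sub>m n) * ((1 / M) \<cdot>\<^sub>m L)
    = (- 1 / M) \<cdot>\<^sub>m (- char_matrix L ?y)"
  proof -
    have "x \<cdot>\<^sub>m 1\<^sub>m n * ((x + D / M) \<cdot>\<^sub>m 1\<^sub>m n) = (x * (x + D / M)) \<cdot>\<^sub>m 1\<^sub>m n"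
      by (intro eq_matI) auto
    moreover have "(- 1\<^sub>m n) * ((1 / M) \<cdot>\<^sub>m L) = - ((1 / M) \<cdot>\<^sub>m L)"
      using L by (intro eq_matI) auto
    ultimately show ?thesis
      using L M by (intro eq_matI) (auto simp: char_matrix_def field_simps power2_eq_square)
  qed
  also have "det \<dots> = (- 1 / M) ^ n * poly (char_poly L) ?y"
    using L char_poly_matrix[OF L, of ?y] by (simp add: char_matrix_def)
  finally show ?thesis .
qed

text \<open>Real polynomials that agree at every point are equal, so the pointwise formula
  suffices.\<close>

lemma char_poly_swing_matrix:
  assumes L: "L \<in> carrier_mat n n" and M: "M \<noteq> 0"
    and ev: "char_poly L = (\<Prod>i=1..n. [:- ev i, 1:])"
  shows "char_poly (swing_matrix n M D L) = (\<Prod>i=1..n. [:ev i / M, D / M, 1:])"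
proof (rule poly_eq_poly_eq_iff[THEN iffD1], rule ext)
  fix x
  have "poly (char_poly (swing_matrix n M D L)) x
    = (- 1 / M) ^ n * (\<Prod>i=1..n. - M * (x\<^sup>2 + D / M * x) - ev i)"
    unfolding poly_char_poly_swing_matrix[OF L M] ev poly_prod
    by (intro arg_cong2[of _ _ _ _ "(*)"] prod.cong refl) simp
  \<comment> \<open>There are as many factors as powers of \<open>- 1 / M\<close>; each factor
    absorbs one and becomes a monic quadratic.\<close>
  also have "\<dots> = (\<Prod>i=1..n. (- 1 / M) * (- M * (x\<^sup>2 + D / M * x) - ev i))"
    unfolding prod.distrib by simp
  also have "\<dots> = poly (\<Prod>i=1..n. [:ev i / M, D / M, 1:]) x"
    using M unfolding poly_prod
    by (intro prod.cong refl) (simp add: field_simps power2_eq_square)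
  finally show "poly (char_poly (swing_matrix n M D L)) x = poly (\<Prod>i=1..n. [:ev i / M, D / M, 1:]) x" .
qed

text \<open>By Vieta it is enough to find the sum and the product of the roots. Of the square root
  only \<open>c * c\<close> enters, so the sign of the radicand does not matter.\<close>

lemma mode_factor_eq_linear_factors:
  assumes M: "M \<noteq> 0"
  shows "mode_factor M D l = [:- mode_root1 M D l, 1:] * [:- mode_root2 M D l, 1:]"
proof -
  define c where "c = csqrt (of_real (D\<^sup>2 - 4 * M * l))"
  have c2: "c * c = of_real (D\<^sup>2 - 4 * M * l)"
    unfolding c_def by (metis power2_csqrt power2_eq_square)
  have r1: "mode_root1 M D l = - of_real (D / (2 * M)) + of_real (1 / (2 * M)) * c"
    and r2: "mode_root2 M D l = - of_real (D / (2 * M)) - of_real (1 / (2 * M)) * c"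
    by (simp_all add: mode_root1_def mode_root2_def c_def)
  have "mode_root2 M D l * mode_root1 M D l = (of_real D * of_real D - c * c) / (4 * of_real M * of_real M)"
    unfolding r1 r2 using M by (simp add: field_simps)
  also have "\<dots> = of_real (l / M)"
    unfolding c2 using M by (simp add: field_simps power2_eq_square)
  finally have prod: "mode_root2 M D l * mode_root1 M D l = of_real (l / M)" .
  have "mode_root2 M D l + mode_root1 M D l = - of_real (D / M)"
    unfolding r1 r2 using M by (simp add: field_simps)
  then have sum: "- mode_root2 M D l - mode_root1 M D l = of_real (D / M)"
    by (simp only: minus_add_distrib[symmetric] diff_conv_add_uminus minus_minus)
  show ?thesis
    using prod sum by (simp add: mode_factor_def)
qed

text \<open>For \<open>l = 0\<close> the frequency is 0, which contradicts
  \<open>2 * \<zeta> * \<omega> = D / M > 0\<close>. For \<open>l > 0\<close> the condition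
  \<open>\<omega> \<ge> 0\<close> selects the root \<open>sqrt (l / M)\<close>, and
  \<open>\<zeta>\<close> follows by division.\<close>

lemma mode_damping_iff:
  assumes M: "M > 0" and D: "D > 0" and l: "l \<ge> 0"
  shows "(\<exists>\<omega>. mode_damping M D l \<omega> \<zeta>) \<longleftrightarrow> l > 0 \<and> \<zeta> = D / (2 * sqrt (M * l))"
proof -
  have eq: "D / (2 * sqrt (M * l)) = D / M / (2 * sqrt (l / M))"
  proof -
    have "M * l = M\<^sup>2 * (l / M)"
      using M by (simp add: power2_eq_square)
    then have "sqrt (M * l) = M * sqrt (l / M)"
      using M by (simp only: real_sqrt_mult real_sqrt_abs abs_of_pos)
    then show ?thesis by simp
  qed
  have "mode_damping M D l \<omega> \<zeta> \<longleftrightarrow> \<omega> = sqrt (l / M) \<and> 2 * \<zeta> * \<omega> = D / M" for \<omega>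
    using M l unfolding mode_damping_def
    by (auto simp: real_sqrt_unique)
  then show ?thesis
    using M D l unfolding eq by (cases "l = 0") (auto simp: field_simps)
qed

lemma smallest_damping_ratio:
  assumes M: "M > 0" and D: "D > 0" and mono: "mono_on {1..n} ev"
    and nonneg: "ev 1 \<ge> 0" and pos: "ev n > 0" and n: "n \<ge> 1"
  shows "is_smallest (D / (2 * sqrt (M * ev n))) (damping_ratios n M D ev)"
proof -
  \<comment> \<open>The ordering carries nonnegativity from the first eigenvalue to all of
    them.\<close>
  have ev: "0 \<le> ev i" "ev i \<le> ev n" if "i \<in> {1..n}" for i
    using mono_onD[OF mono, of 1 i] mono_onD[OF mono, of i n] that nonneg by auto
  \<comment> \<open>Zero modes drop out, so every denominator below is positive and the ratios can
    be compared by monotonicity of \<open>sqrt\<close>.\<close>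
  have ratios: "damping_ratios n M D ev = {D / (2 * sqrt (M * ev i)) | i. i \<in> {1..n} \<and> ev i > 0}"
    unfolding damping_ratios_def using mode_damping_iff[OF M D ev(1)] by auto
  show ?thesis
    unfolding is_smallest_def ratios
    using n pos M D ev(2) by (auto intro!: divide_left_mono mult_pos_pos)
qed

theorem theorem2:
  fixes n :: nat and E :: "nat set set" and B :: "nat \<Rightarrow> nat \<Rightarrow> real"
    and M D :: real and ev :: "nat \<Rightarrow> real" and A :: "complex mat"
  assumes "n \<ge> 1" and "M > 0" and "D > 0"
    and "weighted_network n E B"
    and "ordered_eigenvalues n (laplacian n E B) ev"
    and "ev 1 = 0"
    and "A = map_mat complex_of_real (swing_matrix n M D (laplacian n E B))"
  shows "spectrum A = (\<Union>i\<in>{1..n}. {mode_root1 M D (ev i), mode_root2 M D (ev i)}) \<and>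
         char_poly A = (\<Prod>i=1..n. mode_factor M D (ev i)) \<and>
         (\<forall>i\<in>{1..n}. mode_factor M D (ev i) =
            [:- mode_root1 M D (ev i), 1:] * [:- mode_root2 M D (ev i), 1:]) \<and>
         (E \<noteq> {} \<longrightarrow> is_smallest (D / (2 * sqrt (M * ev n))) (damping_ratios n M D ev))"
proof (intro conjI ballI impI)
  let ?S = "swing_matrix n M D (laplacian n E B)"
  have M: "M \<noteq> 0" using assms(2) by simp
  have S: "?S \<in> carrier_mat (n + n) (n + n)"
    by (rule swing_matrix_carrier[OF laplacian_carrier])
  have A: "A \<in> carrier_mat (n + n) (n + n)"
    using S assms(7) by simp
  have cpL: "char_poly (laplacian n E B) = (\<Prod>i=1..n. [:- ev i, 1:])"
    and mono: "mono_on {1..n} ev"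
    using assms(5) unfolding ordered_eigenvalues_def by auto
  \<comment> \<open>Lets the embedding of real into complex polynomials commute with the product
    over the modes.\<close>
  interpret of_real_poly: map_poly_comm_ring_hom "complex_of_real" ..
  have "char_poly A = map_poly of_real (char_poly ?S)"
    unfolding assms(7) by (rule of_real_hom.char_poly_hom[OF S])
  also have "\<dots> = (\<Prod>i=1..n. mode_factor M D (ev i))"
    unfolding char_poly_swing_matrix[OF laplacian_carrier M cpL]
    by (simp add: of_real_poly.hom_prod mode_factor_def)
  finally show cpA: "char_poly A = (\<Prod>i=1..n. mode_factor M D (ev i))" .
  \<comment> \<open>The spectrum is the root set of \<open>char_poly A\<close>, and a product of
    linear factors vanishes exactly where one of them does.\<close>
  show "spectrum A = (\<Union>i\<in>{1..n}. {mode_root1 M D (ev i), mode_root2 M D (ev i)})"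
    unfolding spectrum_root_char_poly[OF A] cpA mode_factor_eq_linear_factors[OF M]
      poly_prod poly_mult
    by auto
  show "mode_factor M D (ev i) = [:- mode_root1 M D (ev i), 1:] * [:- mode_root2 M D (ev i), 1:]" for i
    by (rule mode_factor_eq_linear_factors[OF M])
  show "is_smallest (D / (2 * sqrt (M * ev n))) (damping_ratios n M D ev)" if "E \<noteq> {}"
    using smallest_damping_ratio[OF assms(2,3) mono _ largest_eigenvalue_pos[OF assms(4) that assms(5)] assms(1)]
      assms(6) by simp
qed

end
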